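(* Let the prior be $p=\mathcal N(0,I_d)$ and the noise distribution be $q=\mathcal N(0,\sigma^2I_{d_y})$ with $\sigma>0$. Suppose $F$ and $\widetilde F$ are diagonal with $F_{ii}=s_i$ and $\widetilde F_{ii}=\alpha_is_i$ for $i=1,\dots,d$, and $O=[I_{d_y}\ \ 0]\in\mathbb R^{d_y\times d}$. For $i=1,\dots,d_y$ define $$\rho_i=\frac{\alpha_i^2s_i^2+\sigma^2}{s_i^2+\sigma^2},\qquad \zeta_i=\frac1{(\alpha_i^2s_i^2+\sigma^2)^2}.$$ Then, with $\mathbb D_a$ and $\mathbb D_l$ as defined in the context, $$\mathbb D_a=-d_y+\sum_{i=1}^{d_y}\left(\log\rho_i+\frac1{\rho_i}\right)+\sum_{i=1}^{d_y}\zeta_i(\alpha_i-1)^2(\alpha_is_i^2-\sigma^2)^2\frac{s_i^2}{\sigma^2},$$ $$\mathbb D_l=-d+\sum_{i=d_y+1}^{d}\left(\alpha_i^2-\log\alpha_i^2\right)+\sum_{i=1}^{d_y}\left(\log\frac{\rho_i}{\alpha_i^2}+\frac{\alpha_i^2}{\rho_i}+\zeta_i(\alpha_i^2-1)^2s_i^2\sigma^2\right).$$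
   Context: Setting. Let $d_y\le d$, let $F,\widetilde F\in\mathbb{R}^{d\times d}$ be invertible (so in the claim all $s_i\neq0$ and $\alpha_i\ne0$), let $O\in\mathbb{R}^{d_y\times d}$, and set $A=OF$, $\widetilde A=O\widetilde F$. The model is $y=Ax+e$ with $x\sim p$ and $e\sim q$ independent. Define probability densities in $x\in\mathbb{R}^d$: $\pi(x|y)\propto q(y-Ax)p(x)$, $\pi_a(x|y)\propto q(y-\widetilde Ax)p(x)$, and $\pi_l(x|y)\propto q(y-Ax)\widetilde p(Fx)$ with $\widetilde p(u)=p(\widetilde F^{-1}u)|\det\widetilde F^{-1}|$. With the expectation over the marginal law of $y$ under the model, $$\mathbb D_a=2\,\mathbb E_y[\mathrm{KL}(\pi_a(\cdot|y)\,\|\,\pi(\cdot|y))],\qquad \mathbb D_l=2\,\mathbb E_y[\mathrm{KL}(\pi_l(\cdot|y)\,\|\,\pi(\cdot|y))].$$ *)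

theory Defs
  imports "HOL-Probability.Probability"
begin

text \<open>
  Densities are real-valued functions with respect to Lebesgue measure \<open>lborel\<close>.
  Throughout, \<open>p\<close> is the prior density of \<open>x\<close> and \<open>q\<close> the density of the noise \<open>e\<close>
  in the model \<open>y = A x + e\<close>, with \<open>A = Ob F\<close> (exact) and \<open>A = Ob Ft\<close> (approximate).
\<close>

definition gaussian_density :: "real^'n \<Rightarrow> real^'n^'n \<Rightarrow> real^'n \<Rightarrow> real" where
  "gaussian_density m C x =
     exp (- ((x - m) \<bullet> (matrix_inv C *v (x - m))) / 2) / sqrt ((2 * pi) ^ CARD('n) * det C)"

definition normalized :: "(real^'n \<Rightarrow> real) \<Rightarrow> (real^'n) measure" where
  "normalized f = density lborel (\<lambda>x. ennreal (f x / (\<integral>x'. f x' \<partial>lborel)))"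

definition posterior ::
    "(real^'n \<Rightarrow> real) \<Rightarrow> (real^'m \<Rightarrow> real) \<Rightarrow> real^'n^'m \<Rightarrow> real^'m \<Rightarrow> (real^'n) measure" where
  "posterior p q A y = normalized (\<lambda>x. q (y - A *v x) * p x)"

definition posterior_a ::
    "(real^'n \<Rightarrow> real) \<Rightarrow> (real^'m \<Rightarrow> real) \<Rightarrow> real^'n^'m \<Rightarrow> real^'n^'n \<Rightarrow> real^'m \<Rightarrow> (real^'n) measure" where
  "posterior_a p q Ob Ft y = normalized (\<lambda>x. q (y - (Ob ** Ft) *v x) * p x)"

text \<open>The density of \<open>Ft x\<close> for \<open>x\<close> with density \<open>p\<close>.\<close>

definition pushed_prior :: "(real^'n \<Rightarrow> real) \<Rightarrow> real^'n^'n \<Rightarrow> real^'n \<Rightarrow> real" where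
  "pushed_prior p Ft u = p (matrix_inv Ft *v u) * \<bar>det (matrix_inv Ft)\<bar>"

definition posterior_l ::
    "(real^'n \<Rightarrow> real) \<Rightarrow> (real^'m \<Rightarrow> real) \<Rightarrow> real^'n^'m \<Rightarrow> real^'n^'n \<Rightarrow> real^'n^'n \<Rightarrow> real^'m \<Rightarrow>
      (real^'n) measure" where
  "posterior_l p q Ob F Ft y =
     normalized (\<lambda>x. q (y - (Ob ** F) *v x) * pushed_prior p Ft (F *v x))"

definition data_law ::
    "(real^'n \<Rightarrow> real) \<Rightarrow> (real^'m \<Rightarrow> real) \<Rightarrow> real^'n^'m \<Rightarrow> (real^'m) measure" where
  "data_law p q A =
     distr (density lborel p \<Otimes>\<^sub>M density lborel q) borel (\<lambda>(x, e). A *v x + e)"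

text \<open>
  The library's \<open>KL_divergence b M N\<close> integrates the log-density of \<open>N\<close> relative to \<open>M\<close>
  against \<open>N\<close>, so it is the divergence of its last argument from the preceding one.
\<close>

abbreviation KL :: "'a measure \<Rightarrow> 'a measure \<Rightarrow> real" where
  "KL N M \<equiv> KL_divergence (exp 1) M N"

definition div_a ::
    "(real^'n \<Rightarrow> real) \<Rightarrow> (real^'m \<Rightarrow> real) \<Rightarrow> real^'n^'m \<Rightarrow> real^'n^'n \<Rightarrow> real^'n^'n \<Rightarrow> real" where
  "div_a p q Ob F Ft =
     2 * (\<integral>y. KL (posterior_a p q Ob Ft y) (posterior p q (Ob ** F) y) \<partial>data_law p q (Ob ** F))"

definition div_l ::
    "(real^'n \<Rightarrow> real) \<Rightarrow> (real^'m \<Rightarrow> real) \<Rightarrow> real^'n^'m \<Rightarrow> real^'n^'n \<Rightarrow> real^'n^'n \<Rightarrow> real" where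
  "div_l p q Ob F Ft =
     2 * (\<integral>y. KL (posterior_l p q Ob F Ft y) (posterior p q (Ob ** F) y) \<partial>data_law p q (Ob ** F))"

end

theory Submission
  imports Defs
begin

text \<open>
  Since \<open>F\<close>, \<open>Ft\<close> are diagonal and \<open>Ob\<close> selects coordinates, the prior, the noise and all three
  posteriors are products of one-dimensional normal densities, so the divergence is a sum over
  coordinates. In each coordinate the difference of the posterior means is linear in the
  observation, and averaging over \<open>y\<close> only needs \<open>E y\<^sub>j\<^sup>2 = s\<^sub>j\<^sup>2 + \<sigma>\<^sup>2\<close>. Unobserved coordinates are
  treated uniformly as observed ones with weight \<open>0\<close>.
\<close>

text \<open>Both approximations are instances of one computation, indexed by a weight and a prior
  deviation per coordinate. On observed coordinates the exact posterior has weight \<open>s\<close>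
  and prior deviation 1. Replacing the forward map only changes the weight, to
  \<open>\<alpha> * s\<close>. Lifting keeps the weights and changes the prior: the inverse of
  \<open>Ft\<close> times \<open>F\<close> is diagonal with entries 1/\<alpha>, so up to a constant
  the pushed prior at \<open>F *v x\<close> is centred normal with deviations |\<alpha>|. Such
  constants are harmless because \<open>normalized\<close> divides them out. No correlation between
  coordinates of y enters: each summand of the divergence is affine in the square of a single y
  coordinate. The constants -dy and -d collect the doubled terms -1/2 of the divergence. In
  \<open>div_a\<close> an unobserved coordinate has the same exact and approximate posterior and
  contributes 0, so only dy of them survive.\<close>

section \<open>Integration against products of one-dimensional normal densities\<close>

definition diag_normal :: "('n \<Rightarrow> real) \<Rightarrow> ('n \<Rightarrow> real) \<Rightarrow> real^'n \<Rightarrow> real" where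
  "diag_normal m \<tau> x = (\<Prod>i\<in>UNIV. normal_density (m i) (\<tau> i) (x $ i))"

text \<open>Lebesgue measure on \<open>real^'n\<close> is the image of a product measure indexed by
  \<open>Basis\<close>, and i \<mapsto> \<open>axis i 1\<close> identifies the index type with
  \<open>Basis\<close>. Fubini for finite products then applies.\<close>

lemma has_bochner_integral_prod_vec:
  fixes f :: "'n::finite \<Rightarrow> real \<Rightarrow> real"
  assumes f: "\<And>i. integrable lborel (f i)"
  shows "has_bochner_integral lborel (\<lambda>x::real^'n. \<Prod>i\<in>UNIV. f i (x $ i))
           (\<Prod>i\<in>UNIV. integral\<^sup>L lborel (f i))"
proof -
  interpret product_sigma_finite "\<lambda>_::real^'n. lborel :: real measure" ..
  let ?T = "\<lambda>g. \<Sum>b\<in>Basis. g b *\<^sub>R (b :: real^'n)"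
  let ?P = "\<Pi>\<^sub>M b\<in>(Basis :: (real^'n) set). (lborel :: real measure)"
  have bij: "bij_betw (\<lambda>i::'n. axis i (1::real)) UNIV Basis"
    by (auto simp: bij_betw_def inj_on_def axis_eq_axis Basis_vec_def)
  have nth: "?T g $ i = g (axis i 1)" for g i
  proof -
    have "?T g $ i = ?T g \<bullet> axis i 1"
      by (simp only: inner_axis real_inner_1_right)
    also have "\<dots> = g (axis i 1)"
      by (rule inner_sum_left_Basis) simp
    finally show ?thesis .
  qed
  have meas [measurable]: "f i \<in> borel_measurable borel" for i
    using borel_measurable_integrable[OF f[of i]] by simp
  have T: "(\<lambda>g. ?T g) \<in> measurable ?P borel"
    by measurable
  have Q: "(\<lambda>x::real^'n. \<Prod>i\<in>UNIV. f i (x $ i)) \<in> borel_measurable borel"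
    by measurable
  have eq: "(\<Prod>i\<in>UNIV. f i (?T g $ i)) = (\<Prod>b\<in>Basis. f (axis_index b) (g b))" for g
    using prod.reindex_bij_betw[OF bij, of "\<lambda>b. f (axis_index b) (g b)"]
    by (simp only: nth axis_index_axis)
  have "integrable ?P (\<lambda>g. \<Prod>b\<in>Basis. f (axis_index b) (g b))"
    by (rule product_integrable_prod) (auto simp: f)
  moreover have "(\<integral>g. (\<Prod>b\<in>Basis. f (axis_index b) (g b)) \<partial>?P)
      = (\<Prod>b\<in>(Basis :: (real^'n) set). integral\<^sup>L lborel (f (axis_index b)))"
    by (rule product_integral_prod) (auto simp: f)
  moreover have "\<dots> = (\<Prod>i\<in>UNIV. integral\<^sup>L lborel (f i))"
    using prod.reindex_bij_betw[OF bij, of "\<lambda>b. integral\<^sup>L lborel (f (axis_index b))"] by simp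
  ultimately show ?thesis
    unfolding has_bochner_integral_iff
    by (subst (1 2) lborel_eq) (simp only: integrable_distr_eq[OF T Q] integral_distr[OF T Q] eq)
qed

lemma borel_measurable_diag_normal [measurable]: "diag_normal m \<tau> \<in> borel_measurable borel"
  unfolding diag_normal_def[abs_def] by measurable

lemma diag_normal_nonneg [simp]: "0 \<le> diag_normal m \<tau> x"
  unfolding diag_normal_def by (intro prod_nonneg) simp

lemma diag_normal_pos: "(\<And>i. 0 < \<tau> i) \<Longrightarrow> 0 < diag_normal m \<tau> x"
  unfolding diag_normal_def by (intro prod_pos) (simp add: normal_density_pos)

text \<open>The factor \<open>h\<close> can be absorbed into the k-th density, which leaves a
  product; all other factors integrate to 1.\<close>

lemma has_bochner_integral_diag_normal_coord:
  fixes m \<tau> :: "'n::finite \<Rightarrow> real"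
  assumes \<tau>: "\<And>i. 0 < \<tau> i"
    and h: "has_bochner_integral lborel (\<lambda>t. normal_density (m k) (\<tau> k) t * h t) r"
  shows "has_bochner_integral lborel (\<lambda>x. diag_normal m \<tau> x * h (x $ k)) r"
proof -
  define f where "f i t = normal_density (m i) (\<tau> i) t * (if i = k then h t else 1)" for i t
  have f: "has_bochner_integral lborel (f i) (if i = k then r else 1)" for i
    using h \<tau> by (auto simp: f_def[abs_def] has_bochner_integral_iff)
  have "(\<Prod>i\<in>UNIV. f i (x $ i)) = diag_normal m \<tau> x * h (x $ k)" for x
    by (simp add: f_def prod.distrib diag_normal_def)
  moreover have "(\<Prod>i\<in>UNIV. integral\<^sup>L lborel (f i)) = r"
    using f by (simp add: has_bochner_integral_iff)
  ultimately show ?thesis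
    using has_bochner_integral_prod_vec[of f] f by (simp add: has_bochner_integral_iff)
qed

lemma has_bochner_integral_diag_normal:
  "(\<And>i. 0 < \<tau> i) \<Longrightarrow> has_bochner_integral lborel (diag_normal m \<tau>) 1"
  using has_bochner_integral_diag_normal_coord[of \<tau> m _ "\<lambda>_. 1"]
  by (simp add: has_bochner_integral_iff)

lemma prob_space_diag_normal:
  assumes "\<And>i. 0 < \<tau> i"
  shows "prob_space (density lborel (diag_normal m \<tau>))"
proof
  show "emeasure (density lborel (diag_normal m \<tau>)) (space (density lborel (diag_normal m \<tau>))) = 1"
    using has_bochner_integral_diag_normal[OF assms, of m]
    by (simp add: emeasure_density nn_integral_eq_integral has_bochner_integral_iff)
qed

lemma normal_second_moment:
  assumes "0 < \<sigma>"
  shows "has_bochner_integral lborel (\<lambda>t. normal_density \<mu> \<sigma> t * (t - a)\<^sup>2) (\<sigma>\<^sup>2 + (\<mu> - a)\<^sup>2)"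
proof -
  \<comment> \<open>This is the expansion of (t - a)^2 around the mean, t - a = (t - \<mu>) + (\<mu>
    - a); the three terms use the central moments of order 2, 1 and 0.\<close>
  have "has_bochner_integral lborel
      (\<lambda>t. normal_density \<mu> \<sigma> t * (t - \<mu>) ^ (2 * 1) + normal_density \<mu> \<sigma> t * (t - \<mu>) ^ (2 * 0 + 1) * (2 * (\<mu> - a))
           + normal_density \<mu> \<sigma> t * (\<mu> - a)\<^sup>2)
      (\<sigma>\<^sup>2 + 0 * (2 * (\<mu> - a)) + 1 * (\<mu> - a)\<^sup>2)"
    using normal_moment_even[OF assms, of \<mu> 1] normal_moment_odd[OF assms, of \<mu> 0] assms
    by (intro has_bochner_integral_add has_bochner_integral_mult_left) (auto simp: has_bochner_integral_iff)
  also have "(\<lambda>t. normal_density \<mu> \<sigma> t * (t - \<mu>) ^ (2 * 1) + normal_density \<mu> \<sigma> t * (t - \<mu>) ^ (2 * 0 + 1) * (2 * (\<mu> - a))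
           + normal_density \<mu> \<sigma> t * (\<mu> - a)\<^sup>2) = (\<lambda>t. normal_density \<mu> \<sigma> t * (t - a)\<^sup>2)"
    by (rule ext) (simp add: power2_eq_square algebra_simps)
  finally show ?thesis by simp
qed

text \<open>The log ratio of two product densities is a sum of functions of single coordinates, so
  one-dimensional second moments suffice. The primed density is the one averaged against; its own
  second moment about its mean gives the -1/2.\<close>

lemma KL_diag_normal:
  fixes m \<tau> m' \<tau>' :: "'n::finite \<Rightarrow> real"
  assumes \<tau>: "\<And>i. 0 < \<tau> i" and \<tau>': "\<And>i. 0 < \<tau>' i"
  shows "KL (density lborel (diag_normal m' \<tau>')) (density lborel (diag_normal m \<tau>))
    = (\<Sum>i\<in>UNIV. ln (\<tau> i / \<tau>' i) + ((\<tau>' i)\<^sup>2 + (m' i - m i)\<^sup>2) / (2 * (\<tau> i)\<^sup>2) - 1 / 2)"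
proof -
  define h where "h i t = ln (\<tau> i / \<tau>' i) + (t - m i)\<^sup>2 * (1 / (2 * (\<tau> i)\<^sup>2))
      - (t - m' i)\<^sup>2 * (1 / (2 * (\<tau>' i)\<^sup>2))" for i t
  have lnd: "ln (normal_density \<mu> s t) = - ln s - ln (sqrt (2 * pi)) - (t - \<mu>)\<^sup>2 * (1 / (2 * s\<^sup>2))" if "0 < s" for \<mu> s t
    using that by (simp add: normal_density_def ln_mult ln_div real_sqrt_mult)
  have ratio: "ln (diag_normal m' \<tau>' x / diag_normal m \<tau> x) = (\<Sum>i\<in>UNIV. h i (x $ i))" for x
  proof -
    have "ln (diag_normal m' \<tau>' x / diag_normal m \<tau> x)
        = ln (diag_normal m' \<tau>' x) - ln (diag_normal m \<tau> x)"
      using diag_normal_pos[of \<tau> m x] diag_normal_pos[of \<tau>' m' x] \<tau> \<tau>' by (simp add: ln_div)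
    also have "\<dots> = (\<Sum>i\<in>UNIV. ln (normal_density (m' i) (\<tau>' i) (x $ i)) - ln (normal_density (m i) (\<tau> i) (x $ i)))"
      unfolding diag_normal_def using \<tau> \<tau>'
      by (subst (1 2) ln_prod) (auto simp: normal_density_pos less_imp_neq[symmetric] sum_subtractf)
    also have "\<dots> = (\<Sum>i\<in>UNIV. h i (x $ i))"
      using less_imp_neq[OF \<tau>, symmetric] less_imp_neq[OF \<tau>', symmetric] \<tau> \<tau>'
      by (intro sum.cong) (auto simp: lnd h_def ln_div)
    finally show ?thesis .
  qed
  have h: "has_bochner_integral lborel (\<lambda>t. normal_density (m' i) (\<tau>' i) t * h i t)
     (ln (\<tau> i / \<tau>' i) + ((\<tau>' i)\<^sup>2 + (m' i - m i)\<^sup>2) / (2 * (\<tau> i)\<^sup>2) - 1 / 2)" for i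
  proof -
    let ?n = "normal_density (m' i) (\<tau>' i)"
    have "has_bochner_integral lborel
       (\<lambda>t. ?n t * ln (\<tau> i / \<tau>' i) + ?n t * (t - m i)\<^sup>2 * (1 / (2 * (\<tau> i)\<^sup>2))
          - ?n t * (t - m' i)\<^sup>2 * (1 / (2 * (\<tau>' i)\<^sup>2)))
       (1 * ln (\<tau> i / \<tau>' i) + ((\<tau>' i)\<^sup>2 + (m' i - m i)\<^sup>2) * (1 / (2 * (\<tau> i)\<^sup>2))
          - ((\<tau>' i)\<^sup>2 + (m' i - m' i)\<^sup>2) * (1 / (2 * (\<tau>' i)\<^sup>2)))"
      using \<tau>'[of i]
      by (intro has_bochner_integral_add has_bochner_integral_diff has_bochner_integral_mult_left
          normal_second_moment) (auto simp: has_bochner_integral_iff)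
    then show ?thesis
      using \<tau>'[of i] by (simp add: h_def algebra_simps add_divide_distrib)
  qed
  have "KL (density lborel (diag_normal m' \<tau>')) (density lborel (diag_normal m \<tau>))
     = (\<integral>x. diag_normal m' \<tau>' x * log (exp 1) (diag_normal m' \<tau>' x / diag_normal m \<tau> x) \<partial>lborel)"
    using diag_normal_pos[of \<tau> m] \<tau>
    by (intro lborel.KL_density_density) (auto simp: less_imp_neq[symmetric])
  also have "\<dots> = (\<integral>x. (\<Sum>i\<in>UNIV. diag_normal m' \<tau>' x * h i (x $ i)) \<partial>lborel)"
    by (simp add: log_def ratio sum_distrib_left)
  also have "has_bochner_integral lborel (\<lambda>x. \<Sum>i\<in>UNIV. diag_normal m' \<tau>' x * h i (x $ i))
     (\<Sum>i\<in>UNIV. ln (\<tau> i / \<tau>' i) + ((\<tau>' i)\<^sup>2 + (m' i - m i)\<^sup>2) / (2 * (\<tau> i)\<^sup>2) - 1 / 2)"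
    by (intro has_bochner_integral_sum has_bochner_integral_diag_normal_coord \<tau>' h)
  then have "(\<integral>x. (\<Sum>i\<in>UNIV. diag_normal m' \<tau>' x * h i (x $ i)) \<partial>lborel)
     = (\<Sum>i\<in>UNIV. ln (\<tau> i / \<tau>' i) + ((\<tau>' i)\<^sup>2 + (m' i - m i)\<^sup>2) / (2 * (\<tau> i)\<^sup>2) - 1 / 2)"
    by (rule has_bochner_integral_integral_eq)
  finally show ?thesis .
qed

section \<open>From matrix covariances to product densities\<close>

lemma matrix_inv_mult_left:
  fixes A :: "'a::semiring_1^'n^'m"
  assumes "invertible A"
  shows "matrix_inv A ** A = mat 1"
  using someI_ex[OF assms[unfolded invertible_def]] by (simp add: matrix_inv_def)

lemma gaussian_density_scalar:
  assumes "0 < \<sigma>"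
  shows "gaussian_density 0 (mat (\<sigma>\<^sup>2)) = (diag_normal (\<lambda>_. 0) (\<lambda>_. \<sigma>) :: real^'n \<Rightarrow> real)"
proof
  fix x :: "real^'n"
  have mm: "mat a ** mat b = (mat (a * b) :: real^'n^'n)" for a b :: real
    by (simp add: matrix_matrix_mult_def mat_def vec_eq_iff mult_delta_left)
  have "invertible (mat (\<sigma>\<^sup>2) :: real^'n^'n)"
    unfolding invertible_def using assms by (intro exI[of _ "mat (1 / \<sigma>\<^sup>2)"]) (simp add: mm)
  then have "matrix_inv (mat (\<sigma>\<^sup>2)) ** mat (\<sigma>\<^sup>2) = (mat 1 :: real^'n^'n)"
    by (rule matrix_inv_mult_left)
  \<comment> \<open>\<open>matrix_inv\<close> is a choice operator, so its value must be forced: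
    multiplying the left-inverse equation by the explicit inverse on the right identifies
    it.\<close>
  then have "matrix_inv (mat (\<sigma>\<^sup>2)) ** mat (\<sigma>\<^sup>2) ** mat (1 / \<sigma>\<^sup>2) = (mat 1 ** mat (1 / \<sigma>\<^sup>2) :: real^'n^'n)"
    by simp
  then have inv: "matrix_inv (mat (\<sigma>\<^sup>2)) = (mat (1 / \<sigma>\<^sup>2) :: real^'n^'n)"
    using assms by (simp add: matrix_mul_assoc[symmetric] mm)
  have mv: "mat a *v x = a *\<^sub>R x" for a :: real
    by (simp add: matrix_vector_mult_def mat_def vec_eq_iff mult_delta_left)
  have det: "det (mat a :: real^'n^'n) = a ^ CARD('n)" for a :: real
    by (subst det_diagonal) (auto simp: mat_def)
  have "diag_normal (\<lambda>_. 0) (\<lambda>_. \<sigma>) x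
      = (\<Prod>i\<in>(UNIV::'n set). 1 / sqrt (2 * pi * \<sigma>\<^sup>2)) * (\<Prod>i\<in>UNIV. exp (- (x $ i)\<^sup>2 / (2 * \<sigma>\<^sup>2)))"
    unfolding diag_normal_def normal_density_def by (simp only: prod.distrib diff_0_right)
  also have "(\<Prod>i\<in>UNIV. exp (- (x $ i)\<^sup>2 / (2 * \<sigma>\<^sup>2))) = exp (- (x \<bullet> x) / (2 * \<sigma>\<^sup>2))"
    by (simp add: exp_sum[symmetric] inner_vec_def power2_eq_square sum_negf sum_divide_distrib)
  also have "(\<Prod>i\<in>(UNIV::'n set). 1 / sqrt (2 * pi * \<sigma>\<^sup>2)) = 1 / sqrt ((2 * pi) ^ CARD('n) * (\<sigma>\<^sup>2) ^ CARD('n))"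
    by (simp add: power_divide real_sqrt_power[symmetric] power_mult_distrib)
  finally show "gaussian_density 0 (mat (\<sigma>\<^sup>2)) x = diag_normal (\<lambda>_. 0) (\<lambda>_. \<sigma>) x"
    by (simp add: gaussian_density_def inv mv det algebra_simps)
qed

section \<open>Posteriors of a linear Gaussian model in closed form\<close>

text \<open>
  Mean and standard deviation of the law of \<open>x\<close> given \<open>y = w x + e\<close>, for \<open>x \<sim> N(0, \<beta>\<^sup>2)\<close> and
  \<open>e \<sim> N(0, \<sigma>\<^sup>2)\<close>.
\<close>

definition posterior_mean :: "real \<Rightarrow> real \<Rightarrow> real \<Rightarrow> real \<Rightarrow> real" where
  "posterior_mean \<sigma> w \<beta> y = \<beta>\<^sup>2 * w * y / (w\<^sup>2 * \<beta>\<^sup>2 + \<sigma>\<^sup>2)"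

definition posterior_dev :: "real \<Rightarrow> real \<Rightarrow> real \<Rightarrow> real" where
  "posterior_dev \<sigma> w \<beta> = \<beta> * \<sigma> / sqrt (w\<^sup>2 * \<beta>\<^sup>2 + \<sigma>\<^sup>2)"

lemma posterior_dev_pos:
  assumes "0 < \<sigma>" "0 < \<beta>"
  shows "0 < posterior_dev \<sigma> w \<beta>"
proof -
  have "0 < w\<^sup>2 * \<beta>\<^sup>2 + \<sigma>\<^sup>2"
    using assms by (intro add_nonneg_pos) auto
  then show ?thesis
    using assms by (simp add: posterior_dev_def)
qed

text \<open>Bayes' rule by completing the square in x: the joint density of (x, y) is the marginal
  of y, with variance w^2 \<beta>^2 + \<sigma>^2, times the conditional of x. The first factor is
  free of x and disappears on normalization.\<close>

lemma normal_density_conjugate: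
  assumes \<sigma>: "0 < \<sigma>" and \<beta>: "0 < \<beta>"
  shows "normal_density 0 \<sigma> (y - w * x) * normal_density 0 \<beta> x
    = normal_density 0 (sqrt (w\<^sup>2 * \<beta>\<^sup>2 + \<sigma>\<^sup>2)) y * normal_density (posterior_mean \<sigma> w \<beta> y) (posterior_dev \<sigma> w \<beta>) x"
proof -
  define D where "D = w\<^sup>2 * \<beta>\<^sup>2 + \<sigma>\<^sup>2"
  have D: "0 < D"
    unfolding D_def using \<sigma> by (intro add_nonneg_pos) auto
  have exponent: "- (y - w * x)\<^sup>2 / (2 * \<sigma>\<^sup>2) + - x\<^sup>2 / (2 * \<beta>\<^sup>2)
      = - y\<^sup>2 / (2 * D) + - (x - \<beta>\<^sup>2 * w * y / D)\<^sup>2 / (2 * (\<beta>\<^sup>2 * \<sigma>\<^sup>2 / D))"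
  proof -
    have "- (y - w * x)\<^sup>2 / (2 * \<sigma>\<^sup>2) + - x\<^sup>2 / (2 * \<beta>\<^sup>2)
       = - (D * x\<^sup>2 - 2 * \<beta>\<^sup>2 * w * y * x + \<beta>\<^sup>2 * y\<^sup>2) / (2 * (\<beta>\<^sup>2 * \<sigma>\<^sup>2))"
      using \<sigma> \<beta> by (simp add: D_def field_simps power2_eq_square)
    moreover have "- (x - \<beta>\<^sup>2 * w * y / D)\<^sup>2 / (2 * (\<beta>\<^sup>2 * \<sigma>\<^sup>2 / D))
       = - (D * x\<^sup>2 - 2 * \<beta>\<^sup>2 * w * y * x + \<beta>\<^sup>2 * \<beta>\<^sup>2 * w\<^sup>2 * y\<^sup>2 / D) / (2 * (\<beta>\<^sup>2 * \<sigma>\<^sup>2))"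
      using \<sigma> \<beta> D by (simp add: field_simps power2_eq_square)
    \<comment> \<open>The y^2 left over after completing the square; it must equal the exponent of
      the marginal of y.\<close>
    moreover have "\<beta>\<^sup>2 * y\<^sup>2 - \<beta>\<^sup>2 * \<beta>\<^sup>2 * w\<^sup>2 * y\<^sup>2 / D = \<beta>\<^sup>2 * \<sigma>\<^sup>2 * y\<^sup>2 / D"
    proof -
      have "\<beta>\<^sup>2 * y\<^sup>2 * D - \<beta>\<^sup>2 * \<beta>\<^sup>2 * w\<^sup>2 * y\<^sup>2 = \<beta>\<^sup>2 * \<sigma>\<^sup>2 * y\<^sup>2"
        by (simp add: D_def algebra_simps)
      then show ?thesis
        using D by (simp add: field_simps)
    qed
    then have "- y\<^sup>2 / (2 * D) = - (\<beta>\<^sup>2 * y\<^sup>2 - \<beta>\<^sup>2 * \<beta>\<^sup>2 * w\<^sup>2 * y\<^sup>2 / D) / (2 * (\<beta>\<^sup>2 * \<sigma>\<^sup>2))"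
      using \<sigma> \<beta> by simp
    ultimately show ?thesis
      by (simp only: add_divide_distrib[symmetric]) (simp add: algebra_simps)
  qed
  have sq: "(sqrt D)\<^sup>2 = D" "(\<beta> * \<sigma> / sqrt D)\<^sup>2 = \<beta>\<^sup>2 * \<sigma>\<^sup>2 / D"
    using D by (simp_all add: power_divide power_mult_distrib)
  have const: "1 / sqrt (2 * pi * \<sigma>\<^sup>2) * (1 / sqrt (2 * pi * \<beta>\<^sup>2))
     = 1 / sqrt (2 * pi * D) * (1 / sqrt (2 * pi * (\<beta>\<^sup>2 * \<sigma>\<^sup>2 / D)))"
    using D \<sigma> \<beta> by (simp add: real_sqrt_mult real_sqrt_divide)
  have "normal_density 0 \<sigma> (y - w * x) * normal_density 0 \<beta> x
     = 1 / sqrt (2 * pi * \<sigma>\<^sup>2) * (1 / sqrt (2 * pi * \<beta>\<^sup>2)) * exp (- (y - w * x)\<^sup>2 / (2 * \<sigma>\<^sup>2) + - x\<^sup>2 / (2 * \<beta>\<^sup>2))"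
    by (simp only: normal_density_def exp_add diff_0_right mult_ac)
  also have "\<dots> = normal_density 0 (sqrt D) y * normal_density (\<beta>\<^sup>2 * w * y / D) (\<beta> * \<sigma> / sqrt D) x"
    unfolding const exponent exp_add normal_density_def sq by (simp only: diff_0_right mult_ac)
  finally show ?thesis
    by (simp add: D_def posterior_mean_def posterior_dev_def)
qed

lemma normalized_scaled_density:
  assumes "has_bochner_integral lborel g 1" and "c \<noteq> 0"
  shows "normalized (\<lambda>x. c * g x) = density lborel g"
  using assms by (simp add: normalized_def has_bochner_integral_iff)

text \<open>
  Outside \<open>range e\<close> the value \<open>inv e i\<close> is arbitrary, which is harmless since the weight \<open>w i\<close>
  vanishes there.
\<close>

lemma normalized_diag_gaussian:
  fixes A :: "real^'n^'m" and e :: "'m::finite \<Rightarrow> 'n::finite"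
  assumes \<sigma>: "0 < \<sigma>" and \<beta>: "\<And>i. 0 < \<beta> i" and e: "inj e" and c: "c \<noteq> 0"
    and A: "\<And>j i. A $ j $ i = (if i = e j then w i else 0)"
    and w: "\<And>i. i \<notin> range e \<Longrightarrow> w i = 0"
  shows "normalized (\<lambda>x. c * (diag_normal (\<lambda>_. 0) (\<lambda>_. \<sigma>) (y - A *v x) * diag_normal (\<lambda>_. 0) \<beta> x))
    = density lborel (diag_normal (\<lambda>i. posterior_mean \<sigma> (w i) (\<beta> i) (y $ inv e i)) (\<lambda>i. posterior_dev \<sigma> (w i) (\<beta> i)))"
proof -
  let ?g = "diag_normal (\<lambda>i. posterior_mean \<sigma> (w i) (\<beta> i) (y $ inv e i)) (\<lambda>i. posterior_dev \<sigma> (w i) (\<beta> i))"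
  \<comment> \<open>The marginal density of the observation of coordinate i. An unobserved
    coordinate has no likelihood factor, hence the value 1.\<close>
  define C where "C i = (if i \<in> range e then normal_density 0 (sqrt ((w i)\<^sup>2 * (\<beta> i)\<^sup>2 + \<sigma>\<^sup>2)) (y $ inv e i) else 1)" for i
  have C: "0 < C i" for i
    using \<sigma> by (auto simp: C_def intro!: normal_density_pos add_nonneg_pos)
  have factor: "diag_normal (\<lambda>_. 0) (\<lambda>_. \<sigma>) (y - A *v x) * diag_normal (\<lambda>_. 0) \<beta> x = prod C UNIV * ?g x" for x
  proof -
    have Ax: "(A *v x) $ j = w (e j) * x $ e j" for j
      by (simp add: matrix_vector_mult_def A mult_delta_left)
    let ?G = "\<lambda>i. normal_density 0 \<sigma> (y $ inv e i - w i * x $ i)"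
    have "diag_normal (\<lambda>_. 0) (\<lambda>_. \<sigma>) (y - A *v x) = (\<Prod>j\<in>UNIV. ?G (e j))"
      using e by (simp add: diag_normal_def Ax)
    also have "\<dots> = (\<Prod>i\<in>range e. ?G i)"
      using prod.reindex[OF e, of ?G] by simp
    \<comment> \<open>Padding with ones turns the product over observations into one over all
      coordinates of x, so that it can be merged factorwise with the prior.\<close>
    also have "\<dots> = (\<Prod>i\<in>UNIV. if i \<in> range e then ?G i else 1)"
      by (simp add: prod.If_cases)
    finally have "diag_normal (\<lambda>_. 0) (\<lambda>_. \<sigma>) (y - A *v x) * diag_normal (\<lambda>_. 0) \<beta> x
      = (\<Prod>i\<in>UNIV. (if i \<in> range e then ?G i else 1) * normal_density 0 (\<beta> i) (x $ i))"
      by (simp only: diag_normal_def prod.distrib)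
    also have "\<dots> = (\<Prod>i\<in>UNIV. C i * normal_density (posterior_mean \<sigma> (w i) (\<beta> i) (y $ inv e i)) (posterior_dev \<sigma> (w i) (\<beta> i)) (x $ i))"
    proof (intro prod.cong refl)
      fix i
      show "(if i \<in> range e then ?G i else 1) * normal_density 0 (\<beta> i) (x $ i)
        = C i * normal_density (posterior_mean \<sigma> (w i) (\<beta> i) (y $ inv e i)) (posterior_dev \<sigma> (w i) (\<beta> i)) (x $ i)"
      proof (cases "i \<in> range e")
        case True
        then show ?thesis
          by (simp add: C_def normal_density_conjugate[OF \<sigma> \<beta>])
      next
        \<comment> \<open>With weight 0 the posterior parameters reduce to mean 0 and deviation
          \<beta>, those of the prior.\<close>
        case False
        then show ?thesis
          using \<sigma> \<beta>[of i] by (simp add: C_def posterior_mean_def posterior_dev_def w)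
      qed
    qed
    also have "\<dots> = prod C UNIV * ?g x"
      by (simp only: prod.distrib diag_normal_def)
    finally show ?thesis .
  qed
  have "normalized (\<lambda>x. c * prod C UNIV * ?g x) = density lborel ?g"
    using c C by (intro normalized_scaled_density has_bochner_integral_diag_normal posterior_dev_pos \<sigma> \<beta>)
      (auto simp: prod_zero_iff less_imp_neq[symmetric])
  then show ?thesis
    by (simp add: factor mult.assoc)
qed

section \<open>Second moments of the data\<close>

text \<open>The cross term 2 u v vanishes in the inner integral because v is centred. The bound (s +
  t)^2 \<le> 2 s^2 + 2 t^2 gives integrability on the product, which Fubini requires.\<close>

lemma has_bochner_integral_pair_sum_square:
  fixes u :: "'a \<Rightarrow> real" and v :: "'b \<Rightarrow> real"
  assumes M: "prob_space M" and N: "prob_space N"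
    and u: "integrable M u" and u2: "has_bochner_integral M (\<lambda>x. (u x)\<^sup>2) a"
    and v: "has_bochner_integral N v 0" and v2: "has_bochner_integral N (\<lambda>x. (v x)\<^sup>2) b"
  shows "has_bochner_integral (M \<Otimes>\<^sub>M N) (\<lambda>(x, z). (u x + v z)\<^sup>2) (a + b)"
proof -
  interpret M: prob_space M by fact
  interpret N: prob_space N by fact
  interpret pair_sigma_finite M N ..
  have [measurable]: "u \<in> borel_measurable M" "v \<in> borel_measurable N"
    using u v by (auto simp: has_bochner_integral_iff)
  have i1: "integrable (M \<Otimes>\<^sub>M N) (\<lambda>z. (u (fst z))\<^sup>2)"
    using integrable_distr[of fst "M \<Otimes>\<^sub>M N" M "\<lambda>x. (u x)\<^sup>2"] u2
    by (simp add: N.distr_pair_fst has_bochner_integral_iff)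
  have i2: "integrable (M \<Otimes>\<^sub>M N) (\<lambda>z. (v (snd z))\<^sup>2)"
    by (rule Fubini_integrable) (use v2 in \<open>auto simp: has_bochner_integral_iff\<close>)
  have int: "integrable (M \<Otimes>\<^sub>M N) (\<lambda>z. (u (fst z) + v (snd z))\<^sup>2)"
  proof (rule Bochner_Integration.integrable_bound)
    show "integrable (M \<Otimes>\<^sub>M N) (\<lambda>z. 2 * (u (fst z))\<^sup>2 + 2 * (v (snd z))\<^sup>2)"
      using i1 i2 by simp
    have "(s + t)\<^sup>2 \<le> 2 * s\<^sup>2 + 2 * t\<^sup>2" for s t :: real
      using sum_squares_bound[of s t] by (simp add: power2_sum)
    then show "AE z in M \<Otimes>\<^sub>M N. norm ((u (fst z) + v (snd z))\<^sup>2) \<le> norm (2 * (u (fst z))\<^sup>2 + 2 * (v (snd z))\<^sup>2)"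
      by simp
  qed simp
  have inner: "(\<integral>z. (u x + v z)\<^sup>2 \<partial>N) = (u x)\<^sup>2 + b" for x
  proof -
    have "has_bochner_integral N (\<lambda>z. (u x)\<^sup>2 + (v z)\<^sup>2 + 2 * u x * v z) ((u x)\<^sup>2 + b + 2 * u x * 0)"
      by (intro has_bochner_integral_add has_bochner_integral_mult_right v v2)
         (simp add: has_bochner_integral_iff N.prob_space)
    then show ?thesis
      by (simp add: has_bochner_integral_iff power2_sum)
  qed
  have "(\<integral>z. (u (fst z) + v (snd z))\<^sup>2 \<partial>(M \<Otimes>\<^sub>M N)) = (\<integral>x. (\<integral>z. (u x + v z)\<^sup>2 \<partial>N) \<partial>M)"
    using integral_fst'[OF int] by simp
  also have "\<dots> = a + b"
    unfolding inner
    using u2 by (simp add: has_bochner_integral_iff M.prob_space)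
  finally show ?thesis
    using int by (simp add: has_bochner_integral_iff case_prod_beta')
qed

lemma data_law_diag_gaussian:
  fixes A :: "real^'n^'m" and e :: "'m::finite \<Rightarrow> 'n::finite"
  assumes \<sigma>: "0 < \<sigma>" and A: "\<And>j i. A $ j $ i = (if i = e j then w i else 0)"
  defines "L \<equiv> data_law (diag_normal (\<lambda>_. 0) (\<lambda>_. 1)) (diag_normal (\<lambda>_. 0) (\<lambda>_. \<sigma>)) A"
  shows "prob_space L"
    and "has_bochner_integral L (\<lambda>y. (y $ j)\<^sup>2) ((w (e j))\<^sup>2 + \<sigma>\<^sup>2)"
proof -
  let ?M = "density lborel (diag_normal (\<lambda>_. 0) (\<lambda>_. 1) :: real^'n \<Rightarrow> real)"
  let ?N = "density lborel (diag_normal (\<lambda>_. 0) (\<lambda>_. \<sigma>) :: real^'m \<Rightarrow> real)"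
  have M: "prob_space ?M" and N: "prob_space ?N"
    using \<sigma> by (auto intro: prob_space_diag_normal)
  interpret M: prob_space ?M by (rule M)
  interpret N: prob_space ?N by (rule N)
  interpret P: pair_prob_space ?M ?N ..
  have T: "(\<lambda>(x, z). A *v x + z) \<in> measurable (?M \<Otimes>\<^sub>M ?N) borel"
  proof -
    have "(\<lambda>z. A *v fst z + snd z) \<in> borel_measurable (borel \<Otimes>\<^sub>M borel)"
      unfolding borel_prod
      by (intro borel_measurable_continuous_onI continuous_intros matrix_vector_mult_linear_continuous_on
          continuous_on_compose2[OF matrix_vector_mult_linear_continuous_on]) auto
    then show ?thesis
      by (simp add: case_prod_beta' cong: measurable_cong_sets)
  qed
  show "prob_space L"
    unfolding L_def data_law_def by (rule P.prob_space_distr[OF T])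
  \<comment> \<open>Transfers a one-dimensional normal moment to a coordinate of the prior or of the
    noise; the dimension type is generic because both are needed.\<close>
  have moment: "has_bochner_integral (density lborel (diag_normal (\<lambda>_. 0) (\<lambda>_. \<tau>) :: real^'k \<Rightarrow> real)) (\<lambda>x. h (x $ k)) r"
    if "0 < \<tau>" "has_bochner_integral lborel (\<lambda>t. normal_density 0 \<tau> t * h t) r"
      and [measurable]: "h \<in> borel_measurable borel"
    for \<tau> r and h :: "real \<Rightarrow> real" and k :: "'k::finite"
    using has_bochner_integral_diag_normal_coord[of "\<lambda>_. \<tau>" "\<lambda>_. 0" k h r] that
    by (intro has_bochner_integral_density) auto
  have "has_bochner_integral ?M (\<lambda>x. w (e j) * x $ e j) (w (e j) * 0)"
    by (intro has_bochner_integral_mult_right moment) (use normal_moment_nz_1[of 1 0] in auto)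
  moreover have "has_bochner_integral ?M (\<lambda>x. (w (e j))\<^sup>2 * (x $ e j)\<^sup>2) ((w (e j))\<^sup>2 * 1)"
    by (intro has_bochner_integral_mult_right moment[of 1 "\<lambda>t. t\<^sup>2"])
       (use normal_second_moment[of 1 0 0] in auto)
  moreover have "has_bochner_integral ?N (\<lambda>z. z $ j) 0"
    by (intro moment) (use normal_moment_nz_1[of \<sigma> 0] \<sigma> in auto)
  moreover have "has_bochner_integral ?N (\<lambda>z. (z $ j)\<^sup>2) (\<sigma>\<^sup>2)"
    by (intro moment[of \<sigma> "\<lambda>t. t\<^sup>2"]) (use normal_second_moment[of \<sigma> 0 0] \<sigma> in auto)
  ultimately have sq: "has_bochner_integral (?M \<Otimes>\<^sub>M ?N) (\<lambda>(x, z). (w (e j) * x $ e j + z $ j)\<^sup>2) ((w (e j))\<^sup>2 + \<sigma>\<^sup>2)"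
    by (intro has_bochner_integral_pair_sum_square[OF M N])
       (auto simp: power_mult_distrib has_bochner_integral_iff)
  have Ax: "(A *v x + z) $ j = w (e j) * x $ e j + z $ j" for x z
    by (simp add: matrix_vector_mult_def A mult_delta_left)
  have Q: "(\<lambda>y::real^'m. (y $ j)\<^sup>2) \<in> borel_measurable borel"
    by measurable
  show "has_bochner_integral L (\<lambda>y. (y $ j)\<^sup>2) ((w (e j))\<^sup>2 + \<sigma>\<^sup>2)"
    using sq[unfolded case_prod_beta] unfolding has_bochner_integral_iff L_def data_law_def
    by (simp only: integrable_distr_eq[OF T Q] integral_distr[OF T Q] case_prod_beta Ax)
qed

section \<open>Expected divergence as a sum over coordinates\<close>

text \<open>
  Twice the expected divergence contributed by one coordinate, when the exact posterior has
  weight \<open>w\<close> and prior deviation \<open>1\<close>, and the approximate one has weight \<open>w'\<close> and prior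
  deviation \<open>\<beta>\<close>.
\<close>

definition kl_coord :: "real \<Rightarrow> real \<Rightarrow> real \<Rightarrow> real \<Rightarrow> real" where
  "kl_coord \<sigma> w w' \<beta> = ln ((w'\<^sup>2 * \<beta>\<^sup>2 + \<sigma>\<^sup>2) / (\<beta>\<^sup>2 * (w\<^sup>2 + \<sigma>\<^sup>2)))
     + \<beta>\<^sup>2 * (w\<^sup>2 + \<sigma>\<^sup>2) / (w'\<^sup>2 * \<beta>\<^sup>2 + \<sigma>\<^sup>2) - 1
     + (\<beta>\<^sup>2 * w' / (w'\<^sup>2 * \<beta>\<^sup>2 + \<sigma>\<^sup>2) - w / (w\<^sup>2 + \<sigma>\<^sup>2))\<^sup>2 * (w\<^sup>2 + \<sigma>\<^sup>2)\<^sup>2 / \<sigma>\<^sup>2"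

text \<open>The posterior mean is linear in y, so its value at 1 is its slope, and w^2 + \<sigma>^2
  stands for the expectation of y^2. Doubling turns the logarithm of a ratio of deviations into that
  of a ratio of variances.\<close>

lemma kl_coord_eq:
  assumes \<sigma>: "0 < \<sigma>" and \<beta>: "0 < \<beta>"
  shows "2 * (ln (posterior_dev \<sigma> w 1 / posterior_dev \<sigma> w' \<beta>)
      + ((posterior_dev \<sigma> w' \<beta>)\<^sup>2 + (posterior_mean \<sigma> w' \<beta> 1 - posterior_mean \<sigma> w 1 1)\<^sup>2 * (w\<^sup>2 + \<sigma>\<^sup>2)) / (2 * (posterior_dev \<sigma> w 1)\<^sup>2) - 1 / 2)
    = kl_coord \<sigma> w w' \<beta>"
proof -
  define D D' where "D = w\<^sup>2 + \<sigma>\<^sup>2" and "D' = w'\<^sup>2 * \<beta>\<^sup>2 + \<sigma>\<^sup>2"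
  have D: "0 < D" and D': "0 < D'"
    unfolding D_def D'_def using \<sigma> by (auto intro: add_nonneg_pos)
  have sq: "(posterior_dev \<sigma> w 1)\<^sup>2 = \<sigma>\<^sup>2 / D" "(posterior_dev \<sigma> w' \<beta>)\<^sup>2 = \<beta>\<^sup>2 * \<sigma>\<^sup>2 / D'"
    using D D' by (simp_all add: posterior_dev_def power_divide power_mult_distrib D_def D'_def)
  have "2 * ln (posterior_dev \<sigma> w 1 / posterior_dev \<sigma> w' \<beta>) = ln ((posterior_dev \<sigma> w 1 / posterior_dev \<sigma> w' \<beta>)\<^sup>2)"
    using posterior_dev_pos[OF \<sigma>, of 1 w] posterior_dev_pos[OF \<sigma> \<beta>, of w'] by (simp add: ln_realpow)
  also have "(posterior_dev \<sigma> w 1 / posterior_dev \<sigma> w' \<beta>)\<^sup>2 = D' / (\<beta>\<^sup>2 * D)"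
    using \<sigma> D D' by (simp add: power_divide sq)
  finally have "2 * (ln (posterior_dev \<sigma> w 1 / posterior_dev \<sigma> w' \<beta>)
      + ((posterior_dev \<sigma> w' \<beta>)\<^sup>2 + (posterior_mean \<sigma> w' \<beta> 1 - posterior_mean \<sigma> w 1 1)\<^sup>2 * D) / (2 * (posterior_dev \<sigma> w 1)\<^sup>2) - 1 / 2)
    = ln (D' / (\<beta>\<^sup>2 * D)) + (\<beta>\<^sup>2 * \<sigma>\<^sup>2 / D' + (\<beta>\<^sup>2 * w' / D' - w / D)\<^sup>2 * D) / (\<sigma>\<^sup>2 / D) - 1"
    unfolding sq by (simp add: posterior_mean_def D_def D'_def)
  also have "(\<beta>\<^sup>2 * \<sigma>\<^sup>2 / D' + (\<beta>\<^sup>2 * w' / D' - w / D)\<^sup>2 * D) / (\<sigma>\<^sup>2 / D)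
    = \<beta>\<^sup>2 * D / D' + (\<beta>\<^sup>2 * w' / D' - w / D)\<^sup>2 * D\<^sup>2 / \<sigma>\<^sup>2"
    using \<sigma> by (simp add: add_divide_distrib distrib_right power2_eq_square)
  finally show ?thesis
    by (simp add: kl_coord_def D_def D'_def)
qed

lemma expected_KL_diag_gaussian:
  fixes A :: "real^'n^'m" and e :: "'m::finite \<Rightarrow> 'n::finite"
  assumes \<sigma>: "0 < \<sigma>" and \<beta>: "\<And>i. 0 < \<beta> i"
    and A: "\<And>j i. A $ j $ i = (if i = e j then w i else 0)"
    and w: "\<And>i. i \<notin> range e \<Longrightarrow> w i = 0" and w': "\<And>i. i \<notin> range e \<Longrightarrow> w' i = 0"
  shows "2 * (\<integral>y. KL
        (density lborel (diag_normal (\<lambda>i. posterior_mean \<sigma> (w' i) (\<beta> i) (y $ inv e i)) (\<lambda>i. posterior_dev \<sigma> (w' i) (\<beta> i))))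
        (density lborel (diag_normal (\<lambda>i. posterior_mean \<sigma> (w i) 1 (y $ inv e i)) (\<lambda>i. posterior_dev \<sigma> (w i) 1)))
      \<partial>data_law (diag_normal (\<lambda>_. 0) (\<lambda>_. 1)) (diag_normal (\<lambda>_. 0) (\<lambda>_. \<sigma>)) A)
    = (\<Sum>i\<in>UNIV. kl_coord \<sigma> (w i) (w' i) (\<beta> i))"
proof -
  let ?L = "data_law (diag_normal (\<lambda>_. 0) (\<lambda>_. 1)) (diag_normal (\<lambda>_. 0) (\<lambda>_. \<sigma>)) A"
  let ?\<tau> = "\<lambda>i. posterior_dev \<sigma> (w i) 1" and ?\<tau>' = "\<lambda>i. posterior_dev \<sigma> (w' i) (\<beta> i)"
  define \<kappa> where "\<kappa> i = posterior_mean \<sigma> (w' i) (\<beta> i) 1 - posterior_mean \<sigma> (w i) 1 1" for i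
  interpret prob_space ?L
    by (rule data_law_diag_gaussian[OF \<sigma> A])
  have diff: "(posterior_mean \<sigma> (w' i) (\<beta> i) t - posterior_mean \<sigma> (w i) 1 t)\<^sup>2 = (\<kappa> i)\<^sup>2 * t\<^sup>2" for i t
    by (simp add: \<kappa>_def posterior_mean_def power_mult_distrib[symmetric] left_diff_distrib)
  have "2 * (\<integral>y. KL
        (density lborel (diag_normal (\<lambda>i. posterior_mean \<sigma> (w' i) (\<beta> i) (y $ inv e i)) ?\<tau>'))
        (density lborel (diag_normal (\<lambda>i. posterior_mean \<sigma> (w i) 1 (y $ inv e i)) ?\<tau>)) \<partial>?L)
      = 2 * (\<integral>y. (\<Sum>i\<in>UNIV. ln (?\<tau> i / ?\<tau>' i) + ((?\<tau>' i)\<^sup>2 + (\<kappa> i)\<^sup>2 * (y $ inv e i)\<^sup>2) * (1 / (2 * (?\<tau> i)\<^sup>2)) - 1 / 2) \<partial>?L)"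
    by (subst KL_diag_normal) (simp_all add: posterior_dev_pos \<sigma> \<beta> diff)
  also have "has_bochner_integral ?L
       (\<lambda>y. \<Sum>i\<in>UNIV. ln (?\<tau> i / ?\<tau>' i) + ((?\<tau>' i)\<^sup>2 + (\<kappa> i)\<^sup>2 * (y $ inv e i)\<^sup>2) * (1 / (2 * (?\<tau> i)\<^sup>2)) - 1 / 2)
       (\<Sum>i\<in>UNIV. ln (?\<tau> i / ?\<tau>' i)
          + ((?\<tau>' i)\<^sup>2 + (\<kappa> i)\<^sup>2 * ((w (e (inv e i)))\<^sup>2 + \<sigma>\<^sup>2)) * (1 / (2 * (?\<tau> i)\<^sup>2)) - 1 / 2)"
    by (intro has_bochner_integral_sum has_bochner_integral_add has_bochner_integral_diff
        has_bochner_integral_mult_left has_bochner_integral_mult_right data_law_diag_gaussian \<sigma> A)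
       (auto simp: has_bochner_integral_iff prob_space)
  then have "2 * (\<integral>y. (\<Sum>i\<in>UNIV. ln (?\<tau> i / ?\<tau>' i) + ((?\<tau>' i)\<^sup>2 + (\<kappa> i)\<^sup>2 * (y $ inv e i)\<^sup>2) * (1 / (2 * (?\<tau> i)\<^sup>2)) - 1 / 2) \<partial>?L)
      = (\<Sum>i\<in>UNIV. 2 * (ln (?\<tau> i / ?\<tau>' i)
          + ((?\<tau>' i)\<^sup>2 + (\<kappa> i)\<^sup>2 * ((w (e (inv e i)))\<^sup>2 + \<sigma>\<^sup>2)) * (1 / (2 * (?\<tau> i)\<^sup>2)) - 1 / 2))"
    by (simp only: has_bochner_integral_iff sum_distrib_left)
  also have "\<dots> = (\<Sum>i\<in>UNIV. kl_coord \<sigma> (w i) (w' i) (\<beta> i))"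
  proof (intro sum.cong refl)
    fix i
    \<comment> \<open>Outside \<open>range e\<close> the index \<open>e (inv e i)\<close> may differ
      from i, but there both weights are 0 and hence \<open>\<kappa> i\<close> is 0.\<close>
    have eq: "(\<kappa> i)\<^sup>2 * ((w (e (inv e i)))\<^sup>2 + \<sigma>\<^sup>2) = (\<kappa> i)\<^sup>2 * ((w i)\<^sup>2 + \<sigma>\<^sup>2)"
      using w[of i] w'[of i] by (cases "i \<in> range e") (auto simp: f_inv_into_f \<kappa>_def posterior_mean_def)
    show "2 * (ln (?\<tau> i / ?\<tau>' i)
          + ((?\<tau>' i)\<^sup>2 + (\<kappa> i)\<^sup>2 * ((w (e (inv e i)))\<^sup>2 + \<sigma>\<^sup>2)) * (1 / (2 * (?\<tau> i)\<^sup>2)) - 1 / 2)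
       = kl_coord \<sigma> (w i) (w' i) (\<beta> i)"
      using kl_coord_eq[OF \<sigma> \<beta>[of i], of "w i" "w' i"]
      unfolding \<kappa>_def[symmetric] by (simp only: eq times_divide_eq_right mult_1_right)
  qed
  finally show ?thesis .
qed

section \<open>Closed forms of the coordinate contributions\<close>

lemma normal_density_rescale:
  assumes "a \<noteq> 0"
  shows "normal_density 0 1 (t / a) = \<bar>a\<bar> * normal_density 0 \<bar>a\<bar> t"
  using assms by (simp add: normal_density_def power_divide real_sqrt_mult)

text \<open>The slope w / (w^2 + \<sigma>^2) takes the same value at w and at \<sigma>^2 / w. So the
  slopes for s and \<alpha> s agree both for \<alpha> = 1 and for \<alpha> s^2 = \<sigma>^2, which
  explains the two squared factors.\<close>

lemma kl_coord_approx:
  assumes \<sigma>: "0 < \<sigma>"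
  shows "kl_coord \<sigma> s (\<alpha> * s) 1
    = ln ((\<alpha>\<^sup>2 * s\<^sup>2 + \<sigma>\<^sup>2) / (s\<^sup>2 + \<sigma>\<^sup>2)) + 1 / ((\<alpha>\<^sup>2 * s\<^sup>2 + \<sigma>\<^sup>2) / (s\<^sup>2 + \<sigma>\<^sup>2)) - 1
      + 1 / (\<alpha>\<^sup>2 * s\<^sup>2 + \<sigma>\<^sup>2)\<^sup>2 * (\<alpha> - 1)\<^sup>2 * (\<alpha> * s\<^sup>2 - \<sigma>\<^sup>2)\<^sup>2 * (s\<^sup>2 / \<sigma>\<^sup>2)"
proof -
  define D D' where "D = s\<^sup>2 + \<sigma>\<^sup>2" and "D' = \<alpha>\<^sup>2 * s\<^sup>2 + \<sigma>\<^sup>2"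
  have D: "0 < D" and D': "0 < D'"
    unfolding D_def D'_def using \<sigma> by (auto intro: add_nonneg_pos)
  have "(\<alpha> * s / D' - s / D) * D = ((\<alpha> - 1) * (\<sigma>\<^sup>2 - \<alpha> * s\<^sup>2) * s) / D'"
  proof -
    have "(\<alpha> * s / D' - s / D) * D = (\<alpha> * s * D - s * D') / D'"
      using D D' by (simp add: field_simps)
    also have "\<alpha> * s * D - s * D' = (\<alpha> - 1) * (\<sigma>\<^sup>2 - \<alpha> * s\<^sup>2) * s"
      by (simp add: D_def D'_def algebra_simps power2_eq_square)
    finally show ?thesis .
  qed
  then have "(\<alpha> * s / D' - s / D)\<^sup>2 * D\<^sup>2 = (((\<alpha> - 1) * (\<sigma>\<^sup>2 - \<alpha> * s\<^sup>2) * s) / D')\<^sup>2"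
    by (simp only: power_mult_distrib[symmetric])
  also have "\<dots> = 1 / D'\<^sup>2 * (\<alpha> - 1)\<^sup>2 * (\<alpha> * s\<^sup>2 - \<sigma>\<^sup>2)\<^sup>2 * s\<^sup>2"
    by (simp add: power_mult_distrib power_divide power2_commute[of "\<sigma>\<^sup>2"])
  finally show ?thesis
    by (simp add: kl_coord_def power_mult_distrib D_def D'_def)
qed

text \<open>Here the weight is unchanged and only the prior variance becomes \<alpha>^2. The terms
  in s^3 cancel in the slope difference, leaving \<alpha>^2 - 1 as a factor.\<close>

lemma kl_coord_lift:
  assumes \<sigma>: "0 < \<sigma>" and \<alpha>: "\<alpha> \<noteq> 0"
  shows "kl_coord \<sigma> s s \<bar>\<alpha>\<bar>
    = ln ((\<alpha>\<^sup>2 * s\<^sup>2 + \<sigma>\<^sup>2) / (s\<^sup>2 + \<sigma>\<^sup>2) / \<alpha>\<^sup>2) + \<alpha>\<^sup>2 / ((\<alpha>\<^sup>2 * s\<^sup>2 + \<sigma>\<^sup>2) / (s\<^sup>2 + \<sigma>\<^sup>2)) - 1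
      + 1 / (\<alpha>\<^sup>2 * s\<^sup>2 + \<sigma>\<^sup>2)\<^sup>2 * (\<alpha>\<^sup>2 - 1)\<^sup>2 * s\<^sup>2 * \<sigma>\<^sup>2"
proof -
  define D D' where "D = s\<^sup>2 + \<sigma>\<^sup>2" and "D' = \<alpha>\<^sup>2 * s\<^sup>2 + \<sigma>\<^sup>2"
  have D: "0 < D" and D': "0 < D'"
    unfolding D_def D'_def using \<sigma> by (auto intro: add_nonneg_pos)
  have "(\<alpha>\<^sup>2 * s / D' - s / D) * D = ((\<alpha>\<^sup>2 - 1) * s * \<sigma>\<^sup>2) / D'"
  proof -
    have "(\<alpha>\<^sup>2 * s / D' - s / D) * D = (\<alpha>\<^sup>2 * s * D - s * D') / D'"
      using D D' by (simp add: field_simps)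
    also have "\<alpha>\<^sup>2 * s * D - s * D' = (\<alpha>\<^sup>2 - 1) * s * \<sigma>\<^sup>2"
      by (simp add: D_def D'_def algebra_simps)
    finally show ?thesis .
  qed
  then have "(\<alpha>\<^sup>2 * s / D' - s / D)\<^sup>2 * D\<^sup>2 = (((\<alpha>\<^sup>2 - 1) * s * \<sigma>\<^sup>2) / D')\<^sup>2"
    by (simp only: power_mult_distrib[symmetric])
  then have "(\<alpha>\<^sup>2 * s / D' - s / D)\<^sup>2 * D\<^sup>2 / \<sigma>\<^sup>2 = 1 / D'\<^sup>2 * (\<alpha>\<^sup>2 - 1)\<^sup>2 * s\<^sup>2 * \<sigma>\<^sup>2"
    using \<sigma> by (simp add: power_mult_distrib power_divide power2_eq_square)
  then show ?thesis
    by (simp add: kl_coord_def D_def D'_def mult.commute[of _ "\<alpha>\<^sup>2"])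
qed

text \<open>Without data both posteriors are the priors: this is twice the divergence of N(0,
  \<alpha>^2) from N(0, 1), and it is 0 at \<alpha> = 1.\<close>

lemma kl_coord_prior:
  assumes "0 < \<sigma>" and "\<alpha> \<noteq> 0"
  shows "kl_coord \<sigma> 0 0 \<bar>\<alpha>\<bar> = \<alpha>\<^sup>2 - ln (\<alpha>\<^sup>2) - 1"
  using assms by (simp add: kl_coord_def ln_div)

section \<open>Identification of weights and priors, and summation over the numbered
  coordinates\<close>

theorem proposition3p3:
  fixes d dy :: nat
    and ix :: "'d::finite \<Rightarrow> nat" and iy :: "'dy::finite \<Rightarrow> nat"
    and F Ft :: "real^'d^'d" and Ob :: "real^'d^'dy"
    and s \<alpha> \<rho> \<zeta> :: "nat \<Rightarrow> real" and \<sigma> :: real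
    and p :: "real^'d \<Rightarrow> real" and q :: "real^'dy \<Rightarrow> real"
  assumes "bij_betw ix UNIV {1..d}" and "bij_betw iy UNIV {1..dy}" and "dy \<le> d"
    and "invertible F" and "invertible Ft"
    and "\<sigma> > 0"
    and "p = gaussian_density 0 (mat 1)"
    and "q = gaussian_density 0 (mat (\<sigma>\<^sup>2))"
    and "\<And>i j. F $ i $ j = (if ix i = ix j then s (ix i) else 0)"
    and "\<And>i j. Ft $ i $ j = (if ix i = ix j then \<alpha> (ix i) * s (ix i) else 0)"
    and "\<And>i j. Ob $ i $ j = (if iy i = ix j then 1 else 0)"
    and "\<And>i. i \<in> {1..dy} \<Longrightarrow> \<rho> i = ((\<alpha> i)\<^sup>2 * (s i)\<^sup>2 + \<sigma>\<^sup>2) / ((s i)\<^sup>2 + \<sigma>\<^sup>2)"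
    and "\<And>i. i \<in> {1..dy} \<Longrightarrow> \<zeta> i = 1 / ((\<alpha> i)\<^sup>2 * (s i)\<^sup>2 + \<sigma>\<^sup>2)\<^sup>2"
  shows "div_a p q Ob F Ft =
           - real dy + (\<Sum>i=1..dy. ln (\<rho> i) + 1 / \<rho> i)
           + (\<Sum>i=1..dy. \<zeta> i * (\<alpha> i - 1)\<^sup>2 * (\<alpha> i * (s i)\<^sup>2 - \<sigma>\<^sup>2)\<^sup>2 * ((s i)\<^sup>2 / \<sigma>\<^sup>2))
       \<and> div_l p q Ob F Ft =
           - real d + (\<Sum>i=dy+1..d. (\<alpha> i)\<^sup>2 - ln ((\<alpha> i)\<^sup>2))
           + (\<Sum>i=1..dy. ln (\<rho> i / (\<alpha> i)\<^sup>2) + (\<alpha> i)\<^sup>2 / \<rho> i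
                          + \<zeta> i * ((\<alpha> i)\<^sup>2 - 1)\<^sup>2 * (s i)\<^sup>2 * \<sigma>\<^sup>2)"
proof -
  note ix = assms(1) and iy = assms(2) and dd = assms(3) and Ft = assms(5) and \<sigma> = assms(6)
  note F_nth = assms(9) and Ft_nth = assms(10) and Ob_nth = assms(11) and \<rho> = assms(12) and \<zeta> = assms(13)
  have ix_eq: "ix i = ix j \<longleftrightarrow> i = j" for i j
    using ix by (auto simp: bij_betw_def inj_eq)
  have p: "p = diag_normal (\<lambda>_. 0) (\<lambda>_. 1)"
    using gaussian_density_scalar[of 1] assms(7) by simp
  have q: "q = diag_normal (\<lambda>_. 0) (\<lambda>_. \<sigma>)"
    using gaussian_density_scalar[OF \<sigma>] assms(8) by simp

  \<comment> \<open>\<open>e j\<close> is the coordinate of x that observation j reads: the position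
    of the single 1 in row j of \<open>Ob\<close>.\<close>
  define e where "e j = inv_into UNIV ix (iy j)" for j
  have iy_range: "iy j \<in> {1..dy}" for j
    using iy by (auto simp: bij_betw_def)
  have ix_e: "ix (e j) = iy j" for j
  proof -
    have "iy j \<in> range ix"
      using iy_range[of j] ix dd by (auto simp: bij_betw_def)
    then show ?thesis
      by (simp add: e_def f_inv_into_f)
  qed
  have e: "inj e"
    using iy by (metis bij_betw_def injD injI ix_e)
  have range_e: "i \<in> range e \<longleftrightarrow> ix i \<le> dy" for i
  proof
    assume "i \<in> range e"
    then show "ix i \<le> dy"
      using iy_range by (auto simp: ix_e)
  next
    assume "ix i \<le> dy"
    moreover have "ix i \<in> {1..d}"
      using ix by (auto simp: bij_betw_def)
    ultimately have "ix i \<in> range iy"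
      using iy by (auto simp: bij_betw_def)
    then obtain j where "ix (e j) = ix i"
      by (auto simp: ix_e)
    then show "i \<in> range e"
      by (auto simp: ix_eq)
  qed

  define w where "w i = (if ix i \<le> dy then s (ix i) else 0)" for i
  define w' where "w' i = (if ix i \<le> dy then \<alpha> (ix i) * s (ix i) else 0)" for i
  have w0: "i \<notin> range e \<Longrightarrow> w i = 0" and w'0: "i \<notin> range e \<Longrightarrow> w' i = 0" for i
    by (auto simp: range_e w_def w'_def)
  have ObM: "(Ob ** M) $ j $ i = M $ e j $ i" for M :: "real^'d^'d" and j i
  proof -
    have "(Ob ** M) $ j $ i = (\<Sum>k\<in>UNIV. (if e j = k then 1 else 0) * M $ k $ i)"
      unfolding matrix_matrix_mult_def by (simp add: Ob_nth ix_e[symmetric] ix_eq)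
    then show ?thesis
      by (simp add: mult_delta_left)
  qed
  have A: "(Ob ** F) $ j $ i = (if i = e j then w i else 0)" for j i
    using range_e[of "e j"] by (auto simp: ObM F_nth ix_eq w_def)
  have A': "(Ob ** Ft) $ j $ i = (if i = e j then w' i else 0)" for j i
    using range_e[of "e j"] by (auto simp: ObM Ft_nth ix_eq w'_def)

  \<comment> \<open>Invertibility of the diagonal \<open>Ft\<close> makes every \<alpha> and every s
    nonzero, on unobserved coordinates too.\<close>
  have "det Ft = (\<Prod>i\<in>UNIV. \<alpha> (ix i) * s (ix i))"
    by (subst det_diagonal) (auto simp: Ft_nth ix_eq)
  then have nz: "\<alpha> (ix i) \<noteq> 0" "s (ix i) \<noteq> 0" for i
    using Ft by (auto simp: invertible_det_nz)
  have \<alpha>_nz: "\<alpha> k \<noteq> 0" if "k \<in> {1..d}" for k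
    using nz(1) that ix by (metis bij_betw_def imageE)

  have post: "posterior p q (Ob ** F) y
      = density lborel (diag_normal (\<lambda>i. posterior_mean \<sigma> (w i) 1 (y $ inv e i)) (\<lambda>i. posterior_dev \<sigma> (w i) 1))" for y
    using normalized_diag_gaussian[OF \<sigma>, of "\<lambda>_. 1" e 1 "Ob ** F" w y] e A w0
    by (simp add: posterior_def p q)
  have post_a: "posterior_a p q Ob Ft y
      = density lborel (diag_normal (\<lambda>i. posterior_mean \<sigma> (w' i) 1 (y $ inv e i)) (\<lambda>i. posterior_dev \<sigma> (w' i) 1))" for y
    using normalized_diag_gaussian[OF \<sigma>, of "\<lambda>_. 1" e 1 "Ob ** Ft" w' y] e A' w'0
    by (simp add: posterior_a_def p q)

  \<comment> \<open>The factors |\<alpha>| come from rescaling the one-dimensional densities, the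
    determinant from the Jacobian in \<open>pushed_prior\<close>.\<close>
  define c where "c = (\<Prod>i\<in>UNIV. \<bar>\<alpha> (ix i)\<bar>) * \<bar>det (matrix_inv Ft)\<bar>"
  have "det (matrix_inv Ft) * det Ft = 1"
    using matrix_inv_mult_left[OF Ft] by (metis det_mul det_I)
  then have c: "c \<noteq> 0"
    using nz by (auto simp: c_def)
  have pushed: "pushed_prior p Ft (F *v x) = c * diag_normal (\<lambda>_. 0) (\<lambda>i. \<bar>\<alpha> (ix i)\<bar>) x" for x
  proof -
    have "(F *v v) $ i = s (ix i) * v $ i" and "(Ft *v v) $ i = \<alpha> (ix i) * s (ix i) * v $ i" for v i
      by (simp_all add: matrix_vector_mult_def F_nth Ft_nth ix_eq mult_delta_left)
    \<comment> \<open>Exhibiting \<open>F *v x\<close> as an image under \<open>Ft\<close> lets the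
      left-inverse law evaluate \<open>matrix_inv Ft\<close> on it.\<close>
    then have "F *v x = Ft *v (\<chi> i. x $ i / \<alpha> (ix i))"
      using nz by (simp add: vec_eq_iff)
    then have "matrix_inv Ft *v (F *v x) = (\<chi> i. x $ i / \<alpha> (ix i))"
      by (simp add: matrix_vector_mul_assoc matrix_inv_mult_left[OF Ft])
    then show ?thesis
      using nz by (simp add: pushed_prior_def p diag_normal_def normal_density_rescale prod.distrib c_def)
  qed
  have post_l: "posterior_l p q Ob F Ft y
      = density lborel (diag_normal (\<lambda>i. posterior_mean \<sigma> (w i) \<bar>\<alpha> (ix i)\<bar> (y $ inv e i)) (\<lambda>i. posterior_dev \<sigma> (w i) \<bar>\<alpha> (ix i)\<bar>))" for y
    using normalized_diag_gaussian[OF \<sigma>, of "\<lambda>i. \<bar>\<alpha> (ix i)\<bar>" e c "Ob ** F" w y] e A w0 c nz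
    by (simp add: posterior_l_def pushed q mult_ac)

  have split: "(\<Sum>i\<in>UNIV. H (ix i)) = (\<Sum>k=1..dy. H k) + (\<Sum>k=dy+1..d. H k)" for H :: "nat \<Rightarrow> real"
  proof -
    have "{1..d} = {1..dy} \<union> {dy+1..d}"
      using dd by auto
    then show ?thesis
      using sum.reindex_bij_betw[OF ix, of H] by (simp add: sum.union_disjoint)
  qed

  have "div_a p q Ob F Ft = (\<Sum>i\<in>UNIV. kl_coord \<sigma> (w i) (w' i) 1)"
    unfolding div_a_def post post_a
    using expected_KL_diag_gaussian[OF \<sigma> _ A w0 w'0, of "\<lambda>_. 1"] by (simp add: p q)
  \<comment> \<open>The deviation 1 is written as \<open>\<bar>1\<bar>\<close> to match
    \<open>kl_coord_prior\<close> at \<alpha> = 1, which makes the second sum vanish.\<close>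
  also have "\<dots> = (\<Sum>k=1..dy. kl_coord \<sigma> (s k) (\<alpha> k * s k) 1) + (\<Sum>k=dy+1..d. kl_coord \<sigma> 0 0 \<bar>1\<bar>)"
    using split[of "\<lambda>k. kl_coord \<sigma> (if k \<le> dy then s k else 0) (if k \<le> dy then \<alpha> k * s k else 0) 1"]
    by (simp add: w_def w'_def)
  also have "(\<Sum>k=1..dy. kl_coord \<sigma> (s k) (\<alpha> k * s k) 1)
      = (\<Sum>k=1..dy. ln (\<rho> k) + 1 / \<rho> k - 1 + \<zeta> k * (\<alpha> k - 1)\<^sup>2 * (\<alpha> k * (s k)\<^sup>2 - \<sigma>\<^sup>2)\<^sup>2 * ((s k)\<^sup>2 / \<sigma>\<^sup>2))"
    by (intro sum.cong refl) (simp only: kl_coord_approx[OF \<sigma>] \<rho> \<zeta>)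
  finally have a: "div_a p q Ob F Ft =
           - real dy + (\<Sum>i=1..dy. ln (\<rho> i) + 1 / \<rho> i)
           + (\<Sum>i=1..dy. \<zeta> i * (\<alpha> i - 1)\<^sup>2 * (\<alpha> i * (s i)\<^sup>2 - \<sigma>\<^sup>2)\<^sup>2 * ((s i)\<^sup>2 / \<sigma>\<^sup>2))"
    by (subst (asm) kl_coord_prior[OF \<sigma>]) (simp_all add: sum.distrib sum_subtractf)

  have "div_l p q Ob F Ft = (\<Sum>i\<in>UNIV. kl_coord \<sigma> (w i) (w i) \<bar>\<alpha> (ix i)\<bar>)"
    unfolding div_l_def post post_l
    using expected_KL_diag_gaussian[OF \<sigma> _ A w0 w0, of "\<lambda>i. \<bar>\<alpha> (ix i)\<bar>"] nz by (simp add: p q)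
  also have "\<dots> = (\<Sum>k=1..dy. kl_coord \<sigma> (s k) (s k) \<bar>\<alpha> k\<bar>) + (\<Sum>k=dy+1..d. kl_coord \<sigma> 0 0 \<bar>\<alpha> k\<bar>)"
    using split[of "\<lambda>k. kl_coord \<sigma> (if k \<le> dy then s k else 0) (if k \<le> dy then s k else 0) \<bar>\<alpha> k\<bar>"]
    by (simp add: w_def)
  also have "(\<Sum>k=1..dy. kl_coord \<sigma> (s k) (s k) \<bar>\<alpha> k\<bar>)
      = (\<Sum>k=1..dy. ln (\<rho> k / (\<alpha> k)\<^sup>2) + (\<alpha> k)\<^sup>2 / \<rho> k - 1 + \<zeta> k * ((\<alpha> k)\<^sup>2 - 1)\<^sup>2 * (s k)\<^sup>2 * \<sigma>\<^sup>2)"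
    using dd by (intro sum.cong refl) (simp add: kl_coord_lift[OF \<sigma> \<alpha>_nz] \<rho> \<zeta>)
  also have "(\<Sum>k=dy+1..d. kl_coord \<sigma> 0 0 \<bar>\<alpha> k\<bar>) = (\<Sum>k=dy+1..d. (\<alpha> k)\<^sup>2 - ln ((\<alpha> k)\<^sup>2) - 1)"
    by (intro sum.cong refl kl_coord_prior \<sigma> \<alpha>_nz) auto
  \<comment> \<open>Here every coordinate keeps its -1: dy observed and d - dy unobserved ones add
    up to -d.\<close>
  finally have "div_l p q Ob F Ft =
           - real d + (\<Sum>i=dy+1..d. (\<alpha> i)\<^sup>2 - ln ((\<alpha> i)\<^sup>2))
           + (\<Sum>i=1..dy. ln (\<rho> i / (\<alpha> i)\<^sup>2) + (\<alpha> i)\<^sup>2 / \<rho> i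
                          + \<zeta> i * ((\<alpha> i)\<^sup>2 - 1)\<^sup>2 * (s i)\<^sup>2 * \<sigma>\<^sup>2)"
    using dd by (simp add: sum.distrib sum_subtractf of_nat_diff)
  with a show ?thesis ..
qed

end
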